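(* Let $\mathbf{A}$ be a distributive nearlattice. Then $\mathbf{A}$ is Stone if and only if every $\alpha$-filter of $A$ is a $\sigma$-filter.
   Context: A distributive nearlattice is a join-semilattice $\langle A,\vee,1\rangle$ with greatest element $1$ in which every principal filter $[a)=\{x\in A\colon a\le x\}$ is a bounded distributive lattice. A filter of $A$ is a subset containing $1$, upward closed, and closed under those binary meets that exist; for filters $F,G$, $F\veebar G$ is the smallest filter containing $F\cup G$. For $a\in A$, $a^{\top}=\{x\in A\colon x\vee a=1\}$ and $a^{\top\top}=\{y\in A\colon y\vee x=1\text{ for all }x\in a^{\top}\}$. A filter $F$ is an $\alpha$-filter if $a^{\top\top}\subseteq F$ for all $a\in F$. For a filter $F$, $\sigma(F)=\{x\in A\colon x^{\top}\veebar F=A\}$, and $F$ is a $\sigma$-filter if $\sigma(F)=F$. $\mathbf{A}$ is Stone if $a^{\top}\veebar a^{\top\top}=A$ for every $a\in A$. *)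

theory Defs
  imports "HOL-Algebra.Lattice"
begin

locale bounded_distributive_lattice = Lattice.bounded_lattice L for L (structure) +
  assumes inf_sup_distrib:
    "\<lbrakk>x \<in> carrier L; y \<in> carrier L; z \<in> carrier L\<rbrakk>
      \<Longrightarrow> x \<sqinter> (y \<squnion> z) = (x \<sqinter> y) \<squnion> (x \<sqinter> z)"

definition principal_filter :: "('a, 'b) gorder_scheme \<Rightarrow> 'a \<Rightarrow> 'a set"
  where "principal_filter L a = {x \<in> carrier L. a \<sqsubseteq>\<^bsub>L\<^esub> x}"

text \<open>
  A principal filter is regarded as an ordered set with the order inherited from
  \<open>L\<close>, so its meets and joins are the ones computed inside the principal filter.
\<close>

locale distributive_nearlattice =
  Lattice.upper_semilattice L + weak_partial_order_top L for L (structure) +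
  assumes principal_filter_lattice:
    "a \<in> carrier L \<Longrightarrow> bounded_distributive_lattice (L\<lparr>carrier := principal_filter L a\<rparr>)"

text \<open>
  The meet of \<open>x\<close> and \<open>y\<close> need not exist in \<open>L\<close>; the last clause quantifies over
  the greatest lower bound, if there is one.
\<close>

definition nl_filter :: "('a, 'b) gorder_scheme \<Rightarrow> 'a set \<Rightarrow> bool"
  where "nl_filter L F \<longleftrightarrow>
    F \<subseteq> carrier L \<and>
    \<top>\<^bsub>L\<^esub> \<in> F \<and>
    (\<forall>x\<in>F. \<forall>y\<in>carrier L. x \<sqsubseteq>\<^bsub>L\<^esub> y \<longrightarrow> y \<in> F) \<and>
    (\<forall>x\<in>F. \<forall>y\<in>F. \<forall>m. greatest L m (Lower L {x, y}) \<longrightarrow> m \<in> F)"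

definition filter_join :: "('a, 'b) gorder_scheme \<Rightarrow> 'a set \<Rightarrow> 'a set \<Rightarrow> 'a set"
  where "filter_join L F G = \<Inter> {H. nl_filter L H \<and> F \<union> G \<subseteq> H}"

definition annihilator :: "('a, 'b) gorder_scheme \<Rightarrow> 'a \<Rightarrow> 'a set"
  where "annihilator L a = {x \<in> carrier L. x \<squnion>\<^bsub>L\<^esub> a = \<top>\<^bsub>L\<^esub>}"

definition double_annihilator :: "('a, 'b) gorder_scheme \<Rightarrow> 'a \<Rightarrow> 'a set"
  where "double_annihilator L a =
    {y \<in> carrier L. \<forall>x\<in>annihilator L a. y \<squnion>\<^bsub>L\<^esub> x = \<top>\<^bsub>L\<^esub>}"

definition alpha_filter :: "('a, 'b) gorder_scheme \<Rightarrow> 'a set \<Rightarrow> bool"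
  where "alpha_filter L F \<longleftrightarrow> nl_filter L F \<and> (\<forall>a\<in>F. double_annihilator L a \<subseteq> F)"

definition sigma :: "('a, 'b) gorder_scheme \<Rightarrow> 'a set \<Rightarrow> 'a set"
  where "sigma L F = {x \<in> carrier L. filter_join L (annihilator L x) F = carrier L}"

definition sigma_filter :: "('a, 'b) gorder_scheme \<Rightarrow> 'a set \<Rightarrow> bool"
  where "sigma_filter L F \<longleftrightarrow> nl_filter L F \<and> sigma L F = F"

definition stone :: "('a, 'b) gorder_scheme \<Rightarrow> bool"
  where "stone L \<longleftrightarrow>
    (\<forall>a\<in>carrier L. filter_join L (annihilator L a) (double_annihilator L a) = carrier L)"

lemma (in distributive_nearlattice) nl_filter_carrier: "nl_filter L (carrier L)"
  unfolding nl_filter_def by (auto simp: greatest_def Lower_def)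

lemma (in distributive_nearlattice) nl_filter_filter_join:
  assumes "F \<subseteq> carrier L" "G \<subseteq> carrier L"
  shows "nl_filter L (filter_join L F G)"
proof -
  have "filter_join L F G \<subseteq> carrier L"
    using nl_filter_carrier assms unfolding filter_join_def by blast
  then show ?thesis
    unfolding nl_filter_def filter_join_def by blast
qed

lemma filter_join_upper: "F \<union> G \<subseteq> filter_join L F G"
  unfolding filter_join_def by blast

lemma filter_join_least: "\<lbrakk>nl_filter L H; F \<union> G \<subseteq> H\<rbrakk> \<Longrightarrow> filter_join L F G \<subseteq> H"
  unfolding filter_join_def by blast

end

theory Submission
  imports Defs
begin

text \<open>
  Meets and joins taken in a principal filter agree with those of \<open>L\<close>, so distributivity
  of the principal filters makes \<open>\<lambda>y. y \<squnion> x\<close> preserve existing meets. Hence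
  \<open>{y. y \<squnion> x \<in> F}\<close> is a filter for every filter \<open>F\<close>. It contains \<open>F\<close> and the
  annihilator of \<open>x\<close>; if these generate the whole carrier, it contains \<open>x\<close>, that is,
  \<open>x = x \<squnion> x \<in> F\<close>. Thus \<open>\<sigma>(F) \<subseteq> F\<close>. The Stone identity at \<open>a\<close> says
  \<open>a \<in> \<sigma>(a\<^sup>\<top>\<^sup>\<top>)\<close>. Every \<open>a\<^sup>\<top>\<^sup>\<top>\<close> is an \<open>\<alpha>\<close>-filter containing \<open>a\<close>, and an \<open>\<alpha>\<close>-filter
  \<open>F\<close> contains \<open>a\<^sup>\<top>\<^sup>\<top>\<close> for each \<open>a \<in> F\<close>, so the theorem follows by monotonicity of
  \<open>\<sigma>\<close>.
\<close>

lemma (in weak_upper_semilattice) join_mono: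
  assumes "x \<sqsubseteq> x'" "y \<sqsubseteq> y'"
    and carr: "x \<in> carrier L" "x' \<in> carrier L" "y \<in> carrier L" "y' \<in> carrier L"
  shows "x \<squnion> y \<sqsubseteq> x' \<squnion> y'"
proof (rule join_le)
  show "x \<sqsubseteq> x' \<squnion> y'"
    using le_trans[OF \<open>x \<sqsubseteq> x'\<close> join_left] carr by simp
  show "y \<sqsubseteq> x' \<squnion> y'"
    using le_trans[OF \<open>y \<sqsubseteq> y'\<close> join_right] carr by simp
qed (use carr in simp_all)

context upper_semilattice
begin

lemma join_assoc:
  "\<lbrakk>x \<in> carrier L; y \<in> carrier L; z \<in> carrier L\<rbrakk> \<Longrightarrow> (x \<squnion> y) \<squnion> z = x \<squnion> (y \<squnion> z)"
  using weak_join_assoc by (simp add: eq_is_equal)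

lemma join_absorb_le:
  "\<lbrakk>x \<sqsubseteq> y; x \<in> carrier L; y \<in> carrier L\<rbrakk> \<Longrightarrow> x \<squnion> y = y"
  by (intro le_antisym join_le join_right) auto

lemma join_join_absorb_le:
  assumes "x \<sqsubseteq> y" "x \<in> carrier L" "y \<in> carrier L" "z \<in> carrier L"
  shows "(x \<squnion> z) \<squnion> y = y \<squnion> z"
proof -
  have "(x \<squnion> z) \<squnion> y = z \<squnion> (x \<squnion> y)"
    using assms by (simp add: join_comm[of L x z] join_assoc)
  also have "\<dots> = y \<squnion> z"
    using assms by (simp add: join_absorb_le join_comm)
  finally show ?thesis .
qed

end

lemma (in weak_lower_semilattice) is_glb_meet:
  "\<lbrakk>x \<in> carrier L; y \<in> carrier L\<rbrakk> \<Longrightarrow> is_glb L (x \<sqinter> y) {x, y}"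
  unfolding meet_def by (rule inf_of_two_greatest)

lemma (in bounded_distributive_lattice) sup_inf_distrib:
  assumes "x \<in> carrier L" "y \<in> carrier L" "z \<in> carrier L"
  shows "x \<squnion> (y \<sqinter> z) = (x \<squnion> y) \<sqinter> (x \<squnion> z)"
proof -
  have "(x \<squnion> y) \<sqinter> (x \<squnion> z) = ((x \<squnion> y) \<sqinter> x) \<squnion> ((x \<squnion> y) \<sqinter> z)"
    using assms by (intro inf_sup_distrib) auto
  also have "(x \<squnion> y) \<sqinter> x = x"
    using le_iff_join[of x "x \<squnion> y"] assms by (simp add: join_left meet_comm)
  also have "(x \<squnion> y) \<sqinter> z = (z \<sqinter> x) \<squnion> (y \<sqinter> z)"
    using inf_sup_distrib[of z x y] assms by (simp add: meet_comm)
  also have "x \<squnion> ((z \<sqinter> x) \<squnion> (y \<sqinter> z)) = (x \<squnion> (z \<sqinter> x)) \<squnion> (y \<sqinter> z)"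
    using assms by (simp add: join_assoc)
  also have "x \<squnion> (z \<sqinter> x) = x"
    using join_absorb_le[of "z \<sqinter> x" x] assms by (simp add: meet_right join_comm)
  finally show ?thesis
    by simp
qed

lemma (in weak_partial_order) join_principal_filter:
  assumes "a \<in> carrier L" "x \<in> principal_filter L a" "y \<in> principal_filter L a"
  shows "x \<squnion>\<^bsub>L\<lparr>carrier := principal_filter L a\<rparr>\<^esub> y = x \<squnion> y"
proof -
  have "Upper (L\<lparr>carrier := principal_filter L a\<rparr>) {x, y} = Upper L {x, y}"
    using assms by (auto simp: Upper_def principal_filter_def intro: le_trans[of a x])
  moreover have "Upper L {x, y} \<subseteq> principal_filter L a"
    using assms by (auto simp: Upper_def principal_filter_def intro: le_trans[of a x])
  ultimately show ?thesis
    using Upper_closed[of L "{x, y}"] by (simp add: join_def sup_def least_def)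
qed

lemma (in weak_upper_semilattice) is_glb_principal_filter_iff:
  assumes a: "a \<in> carrier L" and A: "A \<subseteq> principal_filter L a"
  shows "is_glb (L\<lparr>carrier := principal_filter L a\<rparr>) m A \<longleftrightarrow> is_glb L m A"
    (is "is_glb ?M m A \<longleftrightarrow> _")
proof -
  have A_above: "x \<in> carrier L" "a \<sqsubseteq> x" if "x \<in> A" for x
    using A that by (auto simp: principal_filter_def)
  show ?thesis
  proof
    assume glb: "is_glb ?M m A"
    then have m: "m \<in> carrier L"
      using greatest_closed[OF glb] by (simp add: principal_filter_def)
    show "is_glb L m A"
    proof (rule greatest_LowerI)
      show "m \<sqsubseteq> x" if "x \<in> A" for x
        using greatest_Lower_below[OF glb that] A by simp
    next
      fix w assume w: "w \<in> Lower L A"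
      then have w_carr: "w \<in> carrier L"
        by (simp add: Lower_def)
      have "w \<squnion> a \<sqsubseteq> x" if "x \<in> A" for x
        using w that A_above w_carr a by (intro join_le) (auto simp: Lower_def)
      then have "w \<squnion> a \<in> Lower ?M A"
        using w_carr a by (intro Lower_memI) (auto simp: principal_filter_def join_right)
      then have "w \<squnion> a \<sqsubseteq> m"
        using greatest_le[OF glb] by simp
      then show "w \<sqsubseteq> m"
        using le_trans[OF join_left[OF w_carr a]] w_carr a m by simp
    qed (use A_above m in auto)
  next
    assume glb: "is_glb L m A"
    have "a \<in> Lower L A"
      using A_above a by (intro Lower_memI)
    then have "a \<sqsubseteq> m"
      by (rule greatest_le[OF glb])
    moreover have "Lower ?M A \<subseteq> Lower L A"
      using A by (auto simp: Lower_def principal_filter_def)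
    ultimately show "is_glb ?M m A"
      using A glb by (auto simp: greatest_def Lower_def principal_filter_def)
  qed
qed

lemma (in distributive_nearlattice) is_glb_join:
  assumes glb: "is_glb L m {y, z}"
    and carr: "x \<in> carrier L" "y \<in> carrier L" "z \<in> carrier L"
  shows "is_glb L (m \<squnion> x) {y \<squnion> x, z \<squnion> x}"
proof -
  have m: "m \<in> carrier L" and m_le: "m \<sqsubseteq> y" "m \<sqsubseteq> z"
    using glb carr by (auto intro: greatest_Lower_below)
  let ?M = "L\<lparr>carrier := principal_filter L m\<rparr>"
  interpret M: bounded_distributive_lattice ?M
    by (rule principal_filter_lattice[OF m])
  have in_M: "m \<in> carrier ?M" "y \<in> carrier ?M" "z \<in> carrier ?M" "m \<squnion> x \<in> carrier ?M"
    using m m_le carr by (auto simp: principal_filter_def join_left)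
  have join_M: "(m \<squnion> x) \<squnion>\<^bsub>?M\<^esub> v = v \<squnion> x" if "v \<in> carrier ?M" for v
    using join_principal_filter[OF m] join_join_absorb_le[OF _ m] in_M(4) that carr
    by (simp add: principal_filter_def)
  have "is_glb ?M m {y, z}"
    using is_glb_principal_filter_iff[OF m] glb in_M by simp
  then have m_eq: "m = y \<sqinter>\<^bsub>?M\<^esub> z"
    by (rule M.greatest_unique[OF _ M.is_glb_meet[OF in_M(2,3)]])
  have "m \<squnion> x = (m \<squnion> x) \<squnion>\<^bsub>?M\<^esub> m"
    by (rule join_M[OF in_M(1), symmetric])
  also have "\<dots> = (m \<squnion> x) \<squnion>\<^bsub>?M\<^esub> (y \<sqinter>\<^bsub>?M\<^esub> z)"
    by (rule arg_cong[OF m_eq])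
  also have "\<dots> = ((m \<squnion> x) \<squnion>\<^bsub>?M\<^esub> y) \<sqinter>\<^bsub>?M\<^esub> ((m \<squnion> x) \<squnion>\<^bsub>?M\<^esub> z)"
    by (rule M.sup_inf_distrib[OF in_M(4,2,3)])
  also have "\<dots> = (y \<squnion> x) \<sqinter>\<^bsub>?M\<^esub> (z \<squnion> x)"
    by (simp only: join_M[OF in_M(2)] join_M[OF in_M(3)])
  finally have distrib: "m \<squnion> x = (y \<squnion> x) \<sqinter>\<^bsub>?M\<^esub> (z \<squnion> x)" .
  have joins_in_M: "y \<squnion> x \<in> carrier ?M" "z \<squnion> x \<in> carrier ?M"
    using M.join_closed[OF in_M(4,2)] M.join_closed[OF in_M(4,3)]
    by (simp_all only: join_M[OF in_M(2)] join_M[OF in_M(3)])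
  show ?thesis
    using M.is_glb_meet[OF joins_in_M] is_glb_principal_filter_iff[OF m] joins_in_M
    unfolding distrib by simp
qed

lemma nl_filterI:
  fixes L (structure)
  assumes "F \<subseteq> carrier L" "\<top> \<in> F"
    and "\<And>x y. \<lbrakk>x \<in> F; y \<in> carrier L; x \<sqsubseteq> y\<rbrakk> \<Longrightarrow> y \<in> F"
    and "\<And>x y m. \<lbrakk>x \<in> F; y \<in> F; is_glb L m {x, y}\<rbrakk> \<Longrightarrow> m \<in> F"
  shows "nl_filter L F"
  using assms unfolding nl_filter_def by blast

lemma nl_filter_subset: "nl_filter L F \<Longrightarrow> F \<subseteq> carrier L"
  unfolding nl_filter_def by blast

lemma top_in_nl_filter: "nl_filter L F \<Longrightarrow> \<top>\<^bsub>L\<^esub> \<in> F"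
  unfolding nl_filter_def by blast

lemma nl_filter_upclosed:
  "\<lbrakk>nl_filter L F; x \<in> F; y \<in> carrier L; x \<sqsubseteq>\<^bsub>L\<^esub> y\<rbrakk> \<Longrightarrow> y \<in> F"
  unfolding nl_filter_def by blast

lemma nl_filter_glb:
  "\<lbrakk>nl_filter L F; x \<in> F; y \<in> F; is_glb L m {x, y}\<rbrakk> \<Longrightarrow> m \<in> F"
  unfolding nl_filter_def by blast

lemma filter_join_mono: "G \<subseteq> H \<Longrightarrow> filter_join L F G \<subseteq> filter_join L F H"
  unfolding filter_join_def by blast

lemma (in weak_partial_order_top) nl_filter_carrier_Inter:
  assumes filters: "\<And>F. F \<in> \<F> \<Longrightarrow> nl_filter L F"
  shows "nl_filter L (carrier L \<inter> \<Inter>\<F>)"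
proof (rule nl_filterI)
  show "\<top> \<in> carrier L \<inter> \<Inter>\<F>"
    using filters by (auto intro: top_in_nl_filter)
next
  fix x y assume x: "x \<in> carrier L \<inter> \<Inter>\<F>" and y: "y \<in> carrier L" "x \<sqsubseteq> y"
  have "y \<in> F" if "F \<in> \<F>" for F
    using nl_filter_upclosed[OF filters[OF that]] x y that by blast
  then show "y \<in> carrier L \<inter> \<Inter>\<F>"
    using y by blast
next
  fix x y m assume xy: "x \<in> carrier L \<inter> \<Inter>\<F>" "y \<in> carrier L \<inter> \<Inter>\<F>"
    and glb: "is_glb L m {x, y}"
  have "m \<in> F" if "F \<in> \<F>" for F
    using nl_filter_glb[OF filters[OF that] _ _ glb] xy that by blast
  then show "m \<in> carrier L \<inter> \<Inter>\<F>"
    using glb by simp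
qed blast

definition join_preimage :: "('a, 'b) gorder_scheme \<Rightarrow> 'a \<Rightarrow> 'a set \<Rightarrow> 'a set"
  where "join_preimage L x F = {y \<in> carrier L. y \<squnion>\<^bsub>L\<^esub> x \<in> F}"

lemma annihilator_eq_join_preimage: "annihilator L a = join_preimage L a {\<top>\<^bsub>L\<^esub>}"
  by (simp add: annihilator_def join_preimage_def)

lemma annihilator_sym:
  "\<lbrakk>a \<in> carrier L; x \<in> annihilator L a\<rbrakk> \<Longrightarrow> a \<in> annihilator L x"
  by (simp add: annihilator_def join_comm)

lemma double_annihilator_eq_Inter:
  "double_annihilator L a = carrier L \<inter> \<Inter>(annihilator L ` annihilator L a)"
  by (auto simp: double_annihilator_def annihilator_def)

lemma mem_double_annihilator: "a \<in> carrier L \<Longrightarrow> a \<in> double_annihilator L a"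
  by (auto simp: double_annihilator_eq_Inter dest: annihilator_sym)

lemma double_annihilator_subset:
  assumes b: "b \<in> double_annihilator L a"
  shows "double_annihilator L b \<subseteq> double_annihilator L a"
proof -
  have "annihilator L a \<subseteq> annihilator L b"
  proof
    fix x assume x: "x \<in> annihilator L a"
    then have "x \<in> carrier L" "b \<in> annihilator L x"
      using b by (simp_all add: annihilator_def double_annihilator_def)
    then show "x \<in> annihilator L b"
      by (rule annihilator_sym)
  qed
  then show ?thesis
    unfolding double_annihilator_eq_Inter by blast
qed

lemma stone_iff_mem_sigma_double_annihilator:
  "stone L \<longleftrightarrow> (\<forall>a\<in>carrier L. a \<in> sigma L (double_annihilator L a))"
  by (simp add: stone_def sigma_def)

context distributive_nearlattice
begin

lemma join_top: "x \<in> carrier L \<Longrightarrow> x \<squnion> \<top> = \<top>"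
  by (simp add: join_absorb_le)

lemma nl_filter_top: "nl_filter L {\<top>}"
proof (rule nl_filterI)
  fix x y m assume "x \<in> {\<top>}" "y \<in> {\<top>}" and glb: "is_glb L m {x, y}"
  then have "\<top> \<in> Lower L {x, y}"
    by (intro Lower_memI) auto
  then have "\<top> \<sqsubseteq> m"
    by (rule greatest_le[OF glb])
  then show "m \<in> {\<top>}"
    using glb by (auto intro: le_antisym)
qed (auto intro: le_antisym)

lemma nl_filter_join_preimage:
  assumes F: "nl_filter L F" and x: "x \<in> carrier L"
  shows "nl_filter L (join_preimage L x F)"
proof (rule nl_filterI)
  show "\<top> \<in> join_preimage L x F"
    using top_in_nl_filter[OF F] join_top[OF x] by (simp add: join_preimage_def join_comm)
next
  fix y z assume "y \<in> join_preimage L x F" and z: "z \<in> carrier L" and "y \<sqsubseteq> z"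
  then have "y \<squnion> x \<in> F" "y \<squnion> x \<sqsubseteq> z \<squnion> x"
    using x by (auto simp: join_preimage_def intro: join_mono)
  then show "z \<in> join_preimage L x F"
    using nl_filter_upclosed[OF F] x z by (simp add: join_preimage_def)
next
  fix y z m
  assume "y \<in> join_preimage L x F" "z \<in> join_preimage L x F" and glb: "is_glb L m {y, z}"
  then have "y \<squnion> x \<in> F" "z \<squnion> x \<in> F" and "is_glb L (m \<squnion> x) {y \<squnion> x, z \<squnion> x}"
    using x is_glb_join by (auto simp: join_preimage_def)
  then have "m \<squnion> x \<in> F"
    by (rule nl_filter_glb[OF F])
  then show "m \<in> join_preimage L x F"
    using glb by (simp add: join_preimage_def)
qed (auto simp: join_preimage_def)

lemma subset_join_preimage:
  assumes F: "nl_filter L F" and x: "x \<in> carrier L"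
  shows "F \<subseteq> join_preimage L x F"
proof
  fix y assume y: "y \<in> F"
  then have "y \<in> carrier L"
    using nl_filter_subset[OF F] by blast
  then show "y \<in> join_preimage L x F"
    using nl_filter_upclosed[OF F y] x by (simp add: join_preimage_def join_left)
qed

lemma nl_filter_annihilator: "a \<in> carrier L \<Longrightarrow> nl_filter L (annihilator L a)"
  unfolding annihilator_eq_join_preimage by (intro nl_filter_join_preimage nl_filter_top)

lemma alpha_filter_double_annihilator: "alpha_filter L (double_annihilator L a)"
proof -
  have "nl_filter L (annihilator L x)" if "x \<in> annihilator L a" for x
    using that by (intro nl_filter_annihilator) (simp add: annihilator_def)
  then have "nl_filter L (double_annihilator L a)"
    unfolding double_annihilator_eq_Inter by (intro nl_filter_carrier_Inter) blast
  then show ?thesis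
    by (simp add: alpha_filter_def double_annihilator_subset)
qed

lemma sigma_subset:
  assumes F: "nl_filter L F"
  shows "sigma L F \<subseteq> F"
proof
  fix x assume "x \<in> sigma L F"
  then have x: "x \<in> carrier L" and gen: "filter_join L (annihilator L x) F = carrier L"
    by (auto simp: sigma_def)
  have "annihilator L x \<subseteq> join_preimage L x F"
    using top_in_nl_filter[OF F] by (auto simp: annihilator_def join_preimage_def)
  then have "carrier L \<subseteq> join_preimage L x F"
    unfolding gen[symmetric] using F x
    by (intro filter_join_least nl_filter_join_preimage Un_least subset_join_preimage)
  then have "x \<squnion> x \<in> F"
    using x by (auto simp: join_preimage_def)
  then show "x \<in> F"
    using x by (simp add: join_absorb_le)
qed

lemma sigma_mono:
  assumes "F \<subseteq> G" "G \<subseteq> carrier L"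
  shows "sigma L F \<subseteq> sigma L G"
proof
  fix x assume x: "x \<in> sigma L F"
  have "annihilator L x \<subseteq> carrier L"
    by (auto simp: annihilator_def)
  then have "filter_join L (annihilator L x) G \<subseteq> carrier L"
    using \<open>G \<subseteq> carrier L\<close> by (rule nl_filter_subset[OF nl_filter_filter_join])
  moreover have "carrier L \<subseteq> filter_join L (annihilator L x) G"
    using x filter_join_mono[OF \<open>F \<subseteq> G\<close>, of L "annihilator L x"] by (simp add: sigma_def)
  ultimately show "x \<in> sigma L G"
    using x by (simp add: sigma_def)
qed

lemma stone_imp_alpha_filter_subset_sigma:
  assumes stone: "stone L" and F: "alpha_filter L F"
  shows "F \<subseteq> sigma L F"
proof
  fix a assume "a \<in> F"
  have "F \<subseteq> carrier L"
    using F by (simp add: alpha_filter_def nl_filter_subset)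
  moreover have "double_annihilator L a \<subseteq> F"
    using F \<open>a \<in> F\<close> by (simp add: alpha_filter_def)
  ultimately have "sigma L (double_annihilator L a) \<subseteq> sigma L F"
    by (intro sigma_mono)
  then show "a \<in> sigma L F"
    using stone \<open>a \<in> F\<close> \<open>F \<subseteq> carrier L\<close>
    by (auto simp: stone_iff_mem_sigma_double_annihilator)
qed

end

theorem theorem4p14:
  fixes L :: "('a, 'b) gorder_scheme"
  assumes "distributive_nearlattice L"
  shows "stone L \<longleftrightarrow> (\<forall>F. alpha_filter L F \<longrightarrow> sigma_filter L F)"
proof -
  interpret distributive_nearlattice L
    by (rule assms)
  show ?thesis
  proof (intro iffI allI impI)
    fix F assume "stone L" and F: "alpha_filter L F"
    then have "F \<subseteq> sigma L F"
      by (rule stone_imp_alpha_filter_subset_sigma)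
    moreover have "nl_filter L F"
      using F by (simp add: alpha_filter_def)
    ultimately show "sigma_filter L F"
      using sigma_subset by (auto simp: sigma_filter_def)
  next
    assume "\<forall>F. alpha_filter L F \<longrightarrow> sigma_filter L F"
    then have "sigma L (double_annihilator L a) = double_annihilator L a" for a
      using alpha_filter_double_annihilator by (simp add: sigma_filter_def)
    then show "stone L"
      by (simp add: stone_iff_mem_sigma_double_annihilator mem_double_annihilator)
  qed
qed

end
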